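(* Consider the belief dynamics on $\mathbb{R}^{N_aN_o}$ given, for $i=1,\dots,N_a$ and $j=1,\dots,N_o$, by $$\dot z_{ij}=-d\,z_{ij}+u\Big(S_1\big(\alpha z_{ij}+\gamma\sum_{k\ne i}(A_a)_{ik}z_{kj}\big)+\sum_{l\neq j}S_2\big(\beta (A_o)_{jl}z_{il}+\delta (A_o)_{jl}\sum_{k\neq i}(A_a)_{ik}z_{kl}\big)\Big),$$ with communication graph $\mathcal G_a$ and belief system graph $\mathcal G_o$ having signed adjacency matrices $A_a$, $A_o$, and suppose $K=\max_{\lambda\in\sigma(A_a),\,\mu\in\sigma(A_o)}\operatorname{Re}(\alpha+\gamma\lambda+\beta\mu+\delta\lambda\mu)>0$, $u^*=d/K$. Suppose at least one of the following is true: 1) $\mathcal G_a$ and $\mathcal G_o$ are undirected (i.e. $A_a$ and $A_o$ are symmetric); 2) there exist switching matrices $M_a$ and $M_o$ such that $M_aA_aM_a$ and $M_oA_oM_o$ are both eventually positive. Then the indecision-breaking bifurcation of the origin $\boldsymbol Z=\mathbf 0$ at $u=u^*$ cannot be a Hopf bifurcation; that is, $(\boldsymbol Z,u)=(\mathbf 0,u^* )$ is not a Hopf bifurcation point.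
   Context: $N_a,N_o$ are positive integers. The state is $\boldsymbol Z=(z_{ij})\in\mathbb{R}^{N_aN_o}$. $A_a\in\mathbb{R}^{N_a\times N_a}$ and $A_o\in\mathbb{R}^{N_o\times N_o}$ are signed unweighted adjacency matrices of simple directed graphs: entries in $\{0,1,-1\}$, zero diagonal. Parameters: $d>0$, $u\ge0$, $\alpha,\gamma,\beta,\delta\ge0$. $S_1,S_2:\mathbb{R}\to\mathbb{R}$ are bounded, odd, with $S_r(0)=0$, $S_r'(0)=1$, $S_r''(0)=0$, $S_r'''(0)\ne0$ for $r=1,2$. The Jacobian at the equilibrium $\boldsymbol Z=\mathbf 0$ is $$J(\mathbf 0,u)=(-d+u\alpha)\,I_{N_a}\otimes I_{N_o}+u\gamma\,A_a\otimes I_{N_o}+u\beta\,I_{N_a}\otimes A_o+u\delta\,A_a\otimes A_o .$$ When $K>0$, the origin is locally exponentially stable for $u<u^*=d/K$ and unstable for $u>u^*$; this loss of stability is called the indecision-breaking bifurcation. A switching matrix is a diagonal matrix with diagonal entries in $\{1,-1\}$. A real square matrix $A$ is eventually positive if there is a positive integer $k_0$ such that all entries of $A^k$ are strictly positive for all integers $k>k_0$. Hopf bifurcation point: the equilibrium $\mathbf 0$ at $u=u^*$ is a Hopf bifurcation point if (i) $J(\mathbf 0,u^* )$ has a complex-conjugate pair of eigenvalues $\pm i\omega_0$, $\omega_0\neq0$; (ii) no other eigenvalues of $J(\mathbf 0,u^* )$ (counted with multiplicity) lie on the imaginary axis; (iii) if $r(u)\pm i\omega(u)$ are the eigenvalues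 of $J(\mathbf 0,u)$ smoothly parametrized by $u$ with $r(u^* )=0$, $\omega(u^* )=\omega_0$, then $r'(u^* )\neq0$. *)

theory Defs
  imports "HOL-Analysis.Analysis" "HOL-Computational_Algebra.Polynomial"
begin

text \<open>Matrices over finite index types; agents are indexed by \<open>'a\<close>, options by \<open>'o\<close>, and the
  state is a vector indexed by \<open>'a \<times> 'o\<close>.\<close>

definition signed_adjacency :: "real^'n^'n \<Rightarrow> bool" where
  "signed_adjacency A \<longleftrightarrow> (\<forall>i j. A $ i $ j \<in> {0, 1, -1}) \<and> (\<forall>i. A $ i $ i = 0)"

definition switching_matrix :: "real^'n^'n \<Rightarrow> bool" where
  "switching_matrix M \<longleftrightarrow>
     (\<forall>i j. i \<noteq> j \<longrightarrow> M $ i $ j = 0) \<and> (\<forall>i. M $ i $ i \<in> {1, -1})"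

text \<open>The class operation \<open>^\<close> is not the matrix power here, as \<open>*\<close> is not the matrix product.\<close>

definition matrix_power :: "real^'n^'n \<Rightarrow> nat \<Rightarrow> real^'n^'n" where
  "matrix_power A k = (((**) A) ^^ k) (mat 1)"

definition eventually_positive :: "real^'n^'n \<Rightarrow> bool" where
  "eventually_positive A \<longleftrightarrow> (\<exists>k0>0. \<forall>k>k0. \<forall>i j. matrix_power A k $ i $ j > 0)"

definition spectrum :: "real^'n^'n \<Rightarrow> complex set" where
  "spectrum A = {\<mu>. \<exists>v. v \<noteq> 0 \<and> map_matrix complex_of_real A *v v = \<mu> *s v}"

definition charpoly :: "real^'n^'n \<Rightarrow> complex poly" where
  "charpoly A = det (mat [:0, 1:] - map_matrix (\<lambda>x. [:complex_of_real x:]) A)"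

definition smooth_near :: "(real \<Rightarrow> real) \<Rightarrow> real \<Rightarrow> bool" where
  "smooth_near f x0 \<longleftrightarrow>
     (\<exists>e>0. \<forall>n. \<forall>x\<in>ball x0 e. (deriv ^^ n) f field_differentiable at x)"

text \<open>Bounded and odd, with \<open>S 0 = 0\<close>, \<open>S' 0 = 1\<close>, \<open>S'' 0 = 0\<close>, \<open>S''' 0 \<noteq> 0\<close>. Beyond the existence of
  these three derivatives at \<open>0\<close> no regularity is imposed.\<close>

definition saturating :: "(real \<Rightarrow> real) \<Rightarrow> bool" where
  "saturating S \<longleftrightarrow>
     bounded (range S) \<and> (\<forall>x. S (- x) = - S x) \<and> S 0 = 0 \<and>
     (\<forall>\<^sub>F x in nhds 0. S field_differentiable at x) \<and>
     (\<forall>\<^sub>F x in nhds 0. deriv S field_differentiable at x) \<and>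
     (deriv ^^ 2) S field_differentiable at 0 \<and>
     deriv S 0 = 1 \<and> (deriv ^^ 2) S 0 = 0 \<and> (deriv ^^ 3) S 0 \<noteq> 0"

definition belief_field ::
  "(real \<Rightarrow> real) \<Rightarrow> (real \<Rightarrow> real) \<Rightarrow> real \<Rightarrow> real \<Rightarrow> real \<Rightarrow> real \<Rightarrow> real \<Rightarrow>
   real^'a^'a \<Rightarrow> real^'o^'o \<Rightarrow> real \<Rightarrow> real^('a \<times> 'o) \<Rightarrow> real^('a \<times> 'o)" where
  "belief_field S1 S2 d \<alpha> \<gamma> \<beta> \<delta> Aa Ao u Z = (\<chi> p. case p of (i, j) \<Rightarrow>
     - d * Z $ (i, j) +
     u * (S1 (\<alpha> * Z $ (i, j) + \<gamma> * (\<Sum>k\<in>UNIV - {i}. Aa $ i $ k * Z $ (k, j))) +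
          (\<Sum>l\<in>UNIV - {j}.
             S2 (\<beta> * Ao $ j $ l * Z $ (i, l) +
                 \<delta> * Ao $ j $ l * (\<Sum>k\<in>UNIV - {i}. Aa $ i $ k * Z $ (k, l))))))"

definition belief_K ::
  "real \<Rightarrow> real \<Rightarrow> real \<Rightarrow> real \<Rightarrow> real^'a^'a \<Rightarrow> real^'o^'o \<Rightarrow> real" where
  "belief_K \<alpha> \<gamma> \<beta> \<delta> Aa Ao =
     Max ((\<lambda>(l, m). Re (of_real \<alpha> + of_real \<gamma> * l + of_real \<beta> * m + of_real \<delta> * l * m)) `
            (spectrum Aa \<times> spectrum Ao))"

text \<open>The three conditions are: a pair \<open>\<plusminus> i\<omega>\<^sub>0\<close> of imaginary eigenvalues; both are algebraically simple
  and no other eigenvalue is imaginary; the pair crosses the imaginary axis with nonzero speed.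
  As the pair is simple, its smooth continuation \<open>r u \<plusminus> i\<omega> u\<close> exists and is unique near \<open>u0\<close>
  whenever the Jacobian is smooth in \<open>u\<close>, so quantifying over all continuations is no restriction.\<close>

definition hopf_bifurcation_point ::
  "(real \<Rightarrow> real^'n \<Rightarrow> real^'n) \<Rightarrow> real^'n \<Rightarrow> real \<Rightarrow> bool" where
  "hopf_bifurcation_point F x0 u0 \<longleftrightarrow>
     F u0 x0 = 0 \<and>
     (let J = (\<lambda>u. jacobian (F u) (at x0)) in
      \<exists>\<omega>0. \<omega>0 \<noteq> 0 \<and>
        {Complex 0 \<omega>0, Complex 0 (- \<omega>0)} \<subseteq> spectrum (J u0) \<and>
        order (Complex 0 \<omega>0) (charpoly (J u0)) = 1 \<and>
        order (Complex 0 (- \<omega>0)) (charpoly (J u0)) = 1 \<and>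
        (\<forall>\<mu>\<in>spectrum (J u0). Re \<mu> = 0 \<longrightarrow> \<mu> \<in> {Complex 0 \<omega>0, Complex 0 (- \<omega>0)}) \<and>
        (\<forall>r \<omega>. smooth_near r u0 \<and> smooth_near \<omega> u0 \<and> r u0 = 0 \<and> \<omega> u0 = \<omega>0 \<and>
           (\<forall>\<^sub>F u in nhds u0. Complex (r u) (\<omega> u) \<in> spectrum (J u) \<and>
                              Complex (r u) (- \<omega> u) \<in> spectrum (J u))
           \<longrightarrow> deriv r u0 \<noteq> 0))"

end

theory Submission
  imports Defs
begin

text \<open>A symmetric Jacobian has no nonzero imaginary eigenvalue. In the eventually positive case
  Perron--Frobenius theory gives each adjacency matrix a nonnegative real eigenvalue that dominates
  its spectrum in modulus. The coefficients being nonnegative, the maximum \<open>K\<close> is attained at these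
  two eigenvalues \<open>a\<close> and \<open>b\<close>, so the tensor product of their eigenvectors is an eigenvector of the
  Jacobian at \<open>u = d / K\<close> for the eigenvalue \<open>- d + u * K = 0\<close>, which lies on the imaginary axis
  but is not one of \<open>\<plusminus> i\<omega>\<^sub>0\<close>.\<close>

section \<open>Complex spectrum of a real matrix: characteristic polynomial and finiteness\<close>

lemma map_matrix_of_real_mult:
  "map_matrix complex_of_real (A ** B) = map_matrix complex_of_real A ** map_matrix complex_of_real B"
  by (simp add: vec_eq_iff matrix_matrix_mult_def)

lemma map_matrix_of_real_mat_1: "map_matrix complex_of_real (mat 1) = mat 1"
  by (simp add: vec_eq_iff mat_def)

lemma spectrum_of_real:
  assumes "A *v x = c *s x" "x \<noteq> 0"
  shows "complex_of_real c \<in> spectrum A"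
proof -
  let ?v = "\<chi> i. complex_of_real (x $ i)"
  have "map_matrix complex_of_real A *v ?v = (\<chi> i. complex_of_real ((A *v x) $ i))"
    by (simp add: vec_eq_iff matrix_vector_mult_def)
  also have "\<dots> = complex_of_real c *s ?v"
    by (simp add: assms(1) vec_eq_iff)
  finally have "map_matrix complex_of_real A *v ?v = complex_of_real c *s ?v" .
  moreover have "?v \<noteq> 0"
    using assms(2) by (simp add: vec_eq_iff)
  ultimately show ?thesis
    unfolding spectrum_def by blast
qed

text \<open>By the Leibniz formula, evaluating the polynomial determinant at z gives det(zI - A),
  which vanishes exactly when zI - A has a nontrivial kernel.\<close>

lemma spectrum_eq_charpoly_roots:
  fixes A :: "real^'n^'n"
  shows "spectrum A = {z. poly (charpoly A) z = 0}"
proof -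
  let ?A = "map_matrix complex_of_real A"
  have "poly (charpoly A) z = det (mat z - ?A)" for z
    unfolding charpoly_def det_def poly_sum poly_mult poly_prod
    by (intro sum.cong prod.cong arg_cong2[where f = "(*)"] refl)
      (auto simp: mat_def poly_prod sign_def)
  moreover have "det (mat z - ?A) = 0 \<longleftrightarrow> (\<exists>v. v \<noteq> 0 \<and> ?A *v v = z *s v)" for z
  proof -
    have "mat z *v v = z *s v" for v :: "complex^'n"
      by (simp add: vec_eq_iff matrix_vector_mult_def mat_def if_distrib if_distribR cong: if_cong)
    then have "(mat z - ?A) *v v = 0 \<longleftrightarrow> ?A *v v = z *s v" for v
      by (auto simp: matrix_vector_mult_diff_rdistrib)
    then show ?thesis
      using invertible_det_nz[of "mat z - ?A"] matrix_left_invertible_ker[of "mat z - ?A"]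
      by (auto simp: invertible_left_inverse)
  qed
  ultimately show ?thesis
    by (auto simp: spectrum_def)
qed

lemma bounded_spectrum:
  fixes A :: "real^'n^'n"
  shows "bounded (spectrum A)"
proof -
  obtain K where K: "\<And>v. norm (map_matrix complex_of_real A *v v) \<le> norm v * K"
    using bounded_linear.bounded[OF matrix_vector_mul_bounded_linear[of "map_matrix complex_of_real A"]]
    by blast
  have norm_scale: "norm (c *s v) = cmod c * norm v" for c and v :: "complex^'n"
    by (simp add: norm_vec_def norm_mult L2_set_right_distrib)
  have "cmod z \<le> K" if "z \<in> spectrum A" for z
  proof -
    from that obtain v where v: "v \<noteq> 0" "map_matrix complex_of_real A *v v = z *s v"
      unfolding spectrum_def by blast
    with K[of v] have "cmod z * norm v \<le> K * norm v"
      by (simp add: norm_scale mult.commute)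
    with v show ?thesis by simp
  qed
  then show ?thesis
    unfolding bounded_iff by blast
qed

text \<open>Makes the \<open>Max\<close> in \<open>belief_K\<close> a genuine maximum. A vanishing
  characteristic polynomial would make every complex number an eigenvalue, but eigenvalues are
  bounded by the operator norm; a nonzero polynomial has finitely many roots.\<close>

lemma finite_spectrum: "finite (spectrum A)"
proof -
  have "charpoly A \<noteq> 0"
  proof
    assume "charpoly A = 0"
    then have "spectrum A = UNIV" by (simp add: spectrum_eq_charpoly_roots)
    then show False
      using bounded_spectrum[of A] not_bounded_UNIV by metis
  qed
  then show ?thesis
    by (simp add: spectrum_eq_charpoly_roots poly_roots_finite)
qed

section \<open>Powers of a matrix and their eigenvectors\<close>

lemma spectrum_matrix_power:
  assumes "map_matrix complex_of_real A *v v = z *s v"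
  shows "map_matrix complex_of_real (matrix_power A k) *v v = z ^ k *s v"
proof (induction k)
  case 0
  then show ?case
    by (simp add: matrix_power_def map_matrix_of_real_mat_1)
next
  case (Suc k)
  have "matrix_power A (Suc k) = A ** matrix_power A k"
    by (simp add: matrix_power_def)
  then have "map_matrix complex_of_real (matrix_power A (Suc k)) *v v
      = map_matrix complex_of_real A *v (z ^ k *s v)"
    by (simp add: map_matrix_of_real_mult Suc flip: matrix_vector_mul_assoc)
  then show ?case
    by (simp add: vector_scalar_commute assms vector_smult_assoc mult.commute)
qed

lemma matrix_power_eigenvector:
  assumes "A *v x = c *s x"
  shows "matrix_power A k *v x = c ^ k *s x"
proof (induction k)
  case 0
  then show ?case
    by (simp add: matrix_power_def)
next
  case (Suc k)
  have "matrix_power A (Suc k) = A ** matrix_power A k"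
    by (simp add: matrix_power_def)
  then have "matrix_power A (Suc k) *v x = A *v (c ^ k *s x)"
    by (simp add: Suc flip: matrix_vector_mul_assoc)
  then show ?case
    by (simp add: vector_scalar_commute assms vector_smult_assoc mult.commute)
qed

text \<open>Consequently A maps every eigenspace of one of its powers into itself; this brings the
  Perron vector of a positive power back to A.\<close>

lemma matrix_power_commute: "A ** matrix_power A k = matrix_power A k ** A"
proof (induction k)
  case (Suc k)
  have step: "matrix_power A (Suc k) = A ** matrix_power A k"
    by (simp add: matrix_power_def)
  show ?case
    by (metis Suc step matrix_mul_assoc)
qed (simp add: matrix_power_def)

section \<open>Perron theory for entrywise positive matrices\<close>

lemma positive_matrix_vector_mult:
  fixes P :: "real^'n^'n"
  assumes "\<And>i j. P $ i $ j > 0" "\<And>i. x $ i \<ge> 0" "x \<noteq> 0"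
  shows "(P *v x) $ i > 0"
proof -
  obtain j where "x $ j \<noteq> 0"
    using assms(3) by (auto simp: vec_eq_iff)
  then have "x $ j > 0"
    using assms(2)[of j] by simp
  then have "0 < (\<Sum>j\<in>UNIV. P $ i $ j * x $ j)"
    by (intro sum_pos2[of _ j]) (auto simp: assms less_imp_le)
  then show ?thesis
    by (simp add: matrix_vector_mult_def)
qed

text \<open>Brouwer's theorem on the standard simplex \<open>S\<close>: the map sending x to P x
  divided by its coordinate sum \<open>s x\<close> is continuous from \<open>S\<close> to
  \<open>S\<close>, and a fixed point is an eigenvector for the eigenvalue
  \<open>s x\<close>.\<close>

lemma positive_matrix_eigenvector:
  fixes P :: "real^'n^'n"
  assumes pos: "\<And>i j. P $ i $ j > 0"
  obtains x p where "p > 0" "\<And>i. x $ i > 0" "P *v x = p *s x"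
proof -
  define S where "S = {x :: real^'n. (\<forall>i. x $ i \<ge> 0) \<and> (\<Sum>i\<in>UNIV. x $ i) = 1}"
  define s where "s x = (\<Sum>i\<in>UNIV. (P *v x) $ i)" for x
  have nz: "x \<noteq> 0" if "x \<in> S" for x
    using that by (auto simp: S_def)
  have Ppos: "(P *v x) $ i > 0" if "x \<in> S" for x i
    using that nz[OF that] by (intro positive_matrix_vector_mult pos) (auto simp: S_def)
  have spos: "s x > 0" if "x \<in> S" for x
    unfolding s_def by (intro sum_pos Ppos that) auto
  have "closed S"
    unfolding S_def
    by (intro closed_Collect_conj closed_Collect_all closed_Collect_le closed_Collect_eq continuous_intros)
  moreover have "bounded S"
  proof -
    have "norm x \<le> 1" if "x \<in> S" for x
      using norm_le_l1_cart[of x] that by (simp add: S_def)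
    then show ?thesis
      unfolding bounded_iff by blast
  qed
  ultimately have "compact S"
    by (simp add: compact_eq_bounded_closed)
  moreover have "convex S"
    by (auto simp: S_def convex_def sum.distrib simp flip: sum_distrib_left)
  moreover have "S \<noteq> {}"
  proof -
    have "(\<chi> i. 1 / real CARD('n)) \<in> S"
      by (simp add: S_def)
    then show ?thesis by blast
  qed
  moreover have "continuous_on S (\<lambda>x. inverse (s x) *\<^sub>R (P *v x))"
  proof (intro continuous_on_scaleR continuous_on_inverse)
    show Pc: "continuous_on S ((*v) P)"
      by (intro linear_continuous_on matrix_vector_mul_bounded_linear)
    show "continuous_on S s"
      unfolding s_def by (intro continuous_intros Pc)
    show "\<forall>x\<in>S. s x \<noteq> 0"
      using spos by fastforce
  qed
  moreover have "(\<lambda>x. inverse (s x) *\<^sub>R (P *v x)) \<in> S \<rightarrow> S"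
  proof
    fix x assume x: "x \<in> S"
    have "(\<Sum>i\<in>UNIV. inverse (s x) * (P *v x) $ i) = 1"
      using spos[OF x] by (simp add: s_def flip: sum_distrib_left)
    then show "inverse (s x) *\<^sub>R (P *v x) \<in> S"
      using spos[OF x] Ppos[OF x] by (simp add: S_def less_imp_le)
  qed
  ultimately obtain x where x: "x \<in> S" "inverse (s x) *\<^sub>R (P *v x) = x"
    by (rule brouwer)
  have eq: "P *v x = s x *s x"
    using arg_cong[OF x(2), of "\<lambda>y. s x *\<^sub>R y"] spos[OF x(1)] by (simp add: scalar_mult_eq_scaleR)
  \<comment> \<open>P x is strictly positive and equals a positive multiple of x, so the merely
    nonnegative point x of the simplex is strictly positive.\<close>
  have "x $ i > 0" for i
    using Ppos[OF x(1), of i] spos[OF x(1)] by (simp add: eq zero_less_mult_iff)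
  with eq spos[OF x(1)] that show thesis by blast
qed

text \<open>Subtract from y the largest multiple of x that leaves a nonnegative vector. The
  difference has a zero coordinate and satisfies the same eigenvalue equation; were it nonzero, P
  would make all coordinates of its image positive.\<close>

lemma positive_matrix_eigenvector_unique:
  fixes P :: "real^'n^'n"
  assumes pos: "\<And>i j. P $ i $ j > 0" and xpos: "\<And>i. x $ i > 0"
    and x: "P *v x = p *s x" and y: "P *v y = p *s y"
  obtains c where "y = c *s x"
proof -
  define c where "c = Min (range (\<lambda>i. y $ i / x $ i))"
  have "c \<in> range (\<lambda>i. y $ i / x $ i)"
    unfolding c_def by (intro Min_in) auto
  then obtain i where i: "c = y $ i / x $ i" by blast
  have c_le: "c \<le> y $ j / x $ j" for j
    unfolding c_def by (intro Min_le) auto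
  have nonneg: "(y - c *s x) $ j \<ge> 0" for j
    using c_le[of j] xpos[of j] by (simp add: pos_le_divide_eq)
  have "P *v (y - c *s x) = p *s (y - c *s x)"
    by (simp add: matrix_vector_mult_diff_distrib vector_scalar_commute x y vec_eq_iff algebra_simps)
  \<comment> \<open>At i the minimal ratio \<open>c\<close> is attained, so coordinate i of the
    difference vanishes, and with it coordinate i of p times the difference.\<close>
  then have "(P *v (y - c *s x)) $ i = 0"
    using xpos[of i] by (simp add: i)
  then have "y - c *s x = 0"
    using positive_matrix_vector_mult[OF pos nonneg, of i] by force
  then show thesis
    using that[of c] by simp
qed

text \<open>Measure v by its maximum norm weighted by the positive eigenvector x. In that norm, P x
  = p x and the triangle inequality bound the growth under P by the factor p, while v grows by
  |z|.\<close>

lemma positive_matrix_eigenvalue_bound: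
  fixes P :: "real^'n^'n"
  assumes pos: "\<And>i j. P $ i $ j > 0" and xpos: "\<And>i. x $ i > 0"
    and x: "P *v x = p *s x"
    and v: "map_matrix complex_of_real P *v v = z *s v" "v \<noteq> 0"
  shows "cmod z \<le> p"
proof -
  define c where "c = Max (range (\<lambda>i. cmod (v $ i) / x $ i))"
  have "c \<in> range (\<lambda>i. cmod (v $ i) / x $ i)"
    unfolding c_def by (intro Max_in) auto
  then obtain i where i: "c = cmod (v $ i) / x $ i" by blast
  have c_ge: "cmod (v $ j) / x $ j \<le> c" for j
    unfolding c_def by (intro Max_ge) auto
  have le: "cmod (v $ j) \<le> c * x $ j" for j
    using c_ge[of j] xpos[of j] by (simp add: pos_divide_le_eq)
  have "c > 0"
  proof -
    obtain j where "v $ j \<noteq> 0"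
      using v(2) by (auto simp: vec_eq_iff)
    then have "cmod (v $ j) / x $ j > 0"
      using xpos by simp
    with c_ge[of j] show ?thesis by linarith
  qed
  \<comment> \<open>The estimate is read off at the coordinate i where the weighted maximum
    \<open>c\<close> is attained.\<close>
  have "cmod z * (c * x $ i) = cmod ((z *s v) $ i)"
    using xpos[of i] by (simp add: i norm_mult)
  also have "\<dots> = cmod (\<Sum>j\<in>UNIV. complex_of_real (P $ i $ j) * v $ j)"
    by (simp flip: v(1) add: matrix_vector_mult_def)
  also have "\<dots> \<le> (\<Sum>j\<in>UNIV. P $ i $ j * (c * x $ j))"
    by (intro sum_norm_le) (simp add: norm_mult abs_of_pos[OF pos] le mult_left_mono less_imp_le[OF pos])
  also have "\<dots> = c * (P *v x) $ i"
    by (simp add: matrix_vector_mult_def sum_distrib_left mult_ac)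
  also have "\<dots> = p * (c * x $ i)"
    by (simp add: x)
  finally show ?thesis
    using \<open>c > 0\<close> xpos[of i] by simp
qed

text \<open>A power \<open>P\<close> of \<open>A\<close> is positive and commutes with \<open>A\<close>, so \<open>A\<close> maps the one-dimensional Perron
  eigenspace of \<open>P\<close> to itself. That the next power is positive too makes the eigenvalue positive.\<close>

lemma eventually_positive_dominant_eigenvalue:
  assumes "eventually_positive A"
  obtains r x where "r \<ge> 0" "x \<noteq> 0" "A *v x = r *s x" "\<forall>z\<in>spectrum A. cmod z \<le> r"
proof -
  from assms obtain k where k: "k > 0" "\<And>l i j. l > k \<Longrightarrow> matrix_power A l $ i $ j > 0"
    unfolding eventually_positive_def by blast
  \<comment> \<open>Positivity is only given strictly beyond k, so \<open>Suc k\<close> is the first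
    usable exponent; it also ensures m > 0 for taking m-th roots.\<close>
  define m where "m = Suc k"
  define P where "P = matrix_power A m"
  have Ppos: "P $ i $ j > 0" for i j
    unfolding P_def m_def by (intro k) simp
  obtain x p where x: "p > 0" "\<And>i. x $ i > 0" "P *v x = p *s x"
    using positive_matrix_eigenvector[OF Ppos] by blast
  have "P *v (A *v x) = A *v (P *v x)"
    by (simp add: P_def matrix_vector_mul_assoc matrix_power_commute)
  also have "\<dots> = p *s (A *v x)"
    by (simp add: x(3) vector_scalar_commute)
  finally obtain r where r: "A *v x = r *s x"
    using positive_matrix_eigenvector_unique[OF Ppos x(2,3)] by blast
  have x0: "x \<noteq> 0"
    using x(2) by (metis less_irrefl zero_index)
  have power: "r ^ l > 0" if "l > k" for l
  proof -
    fix i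
    have "(matrix_power A l *v x) $ i > 0"
      using positive_matrix_vector_mult[OF k(2)[OF that] less_imp_le[OF x(2)] x0] .
    then show ?thesis
      using x(2)[of i] by (simp add: matrix_power_eigenvector[OF r] zero_less_mult_iff)
  qed
  have "r ^ Suc m = r * r ^ m" by simp
  then have "r > 0"
    using power[of m] power[of "Suc m"] unfolding m_def
    by (metis lessI less_SucI zero_less_mult_pos2)
  moreover have "p = r ^ m"
  proof -
    fix i
    have "p * x $ i = r ^ m * x $ i"
      using arg_cong[OF x(3), of "\<lambda>y. y $ i"]
      by (simp only: P_def matrix_power_eigenvector[OF r] vector_smult_component)
    then show ?thesis
      using x(2)[of i] by auto
  qed
  moreover have "cmod z \<le> r" if "z \<in> spectrum A" for z
  proof -
    from that obtain v where v: "v \<noteq> 0" "map_matrix complex_of_real A *v v = z *s v"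
      unfolding spectrum_def by blast
    \<comment> \<open>An eigenvector of A for z is one of P for z^m, so the Perron bound for P
      applies and becomes |z| \<le> r after taking m-th roots.\<close>
    have "cmod (z ^ m) \<le> p"
      using positive_matrix_eigenvalue_bound[OF Ppos x(2,3)] spectrum_matrix_power[OF v(2), of m] v(1)
      unfolding P_def by blast
    then have "cmod z ^ m \<le> r ^ m"
      by (simp add: norm_power \<open>p = r ^ m\<close>)
    then show ?thesis
      using \<open>r > 0\<close> power_mono_iff[of "cmod z" r m] by (simp add: m_def)
  qed
  ultimately show thesis
    using that[of r x] r x0 by simp
qed

section \<open>Transfer through switching matrices\<close>

lemma switching_matrix_square:
  assumes "switching_matrix M"
  shows "M ** M = mat 1"
proof -
  have off_diag: "M $ i $ j = 0" if "i \<noteq> j" for i j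
    using assms that by (simp add: switching_matrix_def)
  have "M $ i $ i * M $ i $ i = 1" for i
    using assms by (auto simp: switching_matrix_def dest!: spec[of _ i])
  moreover have "(M ** M) $ i $ j = (if i = j then M $ i $ i * M $ i $ i else 0)" for i j
  proof -
    have "(M ** M) $ i $ j = (\<Sum>k\<in>UNIV. if k = i then M $ i $ i * M $ i $ j else 0)"
      unfolding matrix_matrix_mult_def vec_lambda_beta by (intro sum.cong) (auto simp: off_diag)
    then show ?thesis by (simp add: off_diag)
  qed
  ultimately show ?thesis
    by (simp add: vec_eq_iff mat_def)
qed

text \<open>M is its own inverse, so M A M is similar to A: multiplication by M carries the dominant
  eigenvector over to A, and eigenvectors of A back to M A M, where the modulus bound holds.\<close>

lemma switched_dominant_eigenvalue:
  assumes M: "switching_matrix M" and "eventually_positive (M ** A ** M)"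
  obtains r x where "r \<ge> 0" "x \<noteq> 0" "A *v x = r *s x" "\<forall>z\<in>spectrum A. cmod z \<le> r"
proof -
  let ?B = "M ** A ** M"
  obtain r x where x: "r \<ge> 0" "x \<noteq> 0" "?B *v x = r *s x" "\<forall>z\<in>spectrum ?B. cmod z \<le> r"
    using eventually_positive_dominant_eigenvalue[OF assms(2)] by blast
  have MM: "M ** M = mat 1"
    using switching_matrix_square[OF M] .
  then have MMc: "map_matrix complex_of_real M ** map_matrix complex_of_real M = mat 1"
    by (metis map_matrix_of_real_mult map_matrix_of_real_mat_1)
  have M_inj: "M *v y = 0 \<longleftrightarrow> y = 0" for y
    using matrix_vector_mul_assoc[of M M y] MM by (metis matrix_vector_mul_lid matrix_vector_mult_0_right)
  have Mc_inj: "map_matrix complex_of_real M *v y = 0 \<longleftrightarrow> y = 0" for y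
    using matrix_vector_mul_assoc[of "map_matrix complex_of_real M" "map_matrix complex_of_real M" y] MMc
    by (metis matrix_vector_mul_lid matrix_vector_mult_0_right)
  have "M *v (?B *v x) = A *v (M *v x)"
    by (simp add: matrix_vector_mul_assoc matrix_mul_assoc MM)
  then have "A *v (M *v x) = r *s (M *v x)"
    by (simp add: x(3) vector_scalar_commute)
  moreover have "z \<in> spectrum ?B" if "z \<in> spectrum A" for z
  proof -
    let ?M = "map_matrix complex_of_real M" and ?A = "map_matrix complex_of_real A"
    from that obtain v where v: "v \<noteq> 0" "?A *v v = z *s v"
      unfolding spectrum_def by blast
    have "map_matrix complex_of_real ?B *v (?M *v v) = ?M *v (?A *v ((?M ** ?M) *v v))"
      by (simp add: map_matrix_of_real_mult matrix_vector_mul_assoc matrix_mul_assoc)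
    also have "\<dots> = z *s (?M *v v)"
      by (simp add: MMc v(2) vector_scalar_commute)
    finally show ?thesis
      using v(1) Mc_inj unfolding spectrum_def by blast
  qed
  ultimately show thesis
    using that[of r "M *v x"] x M_inj by blast
qed

section \<open>Kronecker products and the matrix J(0,u)\<close>

definition kron :: "real^'a^'a \<Rightarrow> real^'o^'o \<Rightarrow> real^('a \<times> 'o)^('a \<times> 'o)" where
  "kron A B = (\<chi> p q. A $ fst p $ fst q * B $ snd p $ snd q)"

text \<open>The closed formula for J(0,u); \<open>jacobian_belief_field\<close> identifies it with
  the actual Jacobian of the field.\<close>

definition belief_jacobian ::
  "real \<Rightarrow> real \<Rightarrow> real \<Rightarrow> real \<Rightarrow> real \<Rightarrow> real^'a^'a \<Rightarrow> real^'o^'o \<Rightarrow> real \<Rightarrow> real^('a \<times> 'o)^('a \<times> 'o)" where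
  "belief_jacobian d \<alpha> \<gamma> \<beta> \<delta> Aa Ao u =
     (- d + u * \<alpha>) *\<^sub>R kron (mat 1) (mat 1) + (u * \<gamma>) *\<^sub>R kron Aa (mat 1) +
     (u * \<beta>) *\<^sub>R kron (mat 1) Ao + (u * \<delta>) *\<^sub>R kron Aa Ao"

text \<open>Options are summed outside and agents inside, matching the nesting of the sums in
  \<open>belief_field\<close>.\<close>

lemma kron_mult_vec_nth:
  "(kron A B *v Z) $ (i, j) = (\<Sum>l\<in>UNIV. B $ j $ l * (\<Sum>k\<in>UNIV. A $ i $ k * Z $ (k, l)))"
proof -
  have "(kron A B *v Z) $ (i, j) = (\<Sum>k\<in>UNIV. \<Sum>l\<in>UNIV. A $ i $ k * B $ j $ l * Z $ (k, l))"
    by (simp add: matrix_vector_mult_def kron_def sum.cartesian_product UNIV_Times_UNIV case_prod_unfold)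
  also have "\<dots> = (\<Sum>l\<in>UNIV. \<Sum>k\<in>UNIV. A $ i $ k * B $ j $ l * Z $ (k, l))"
    by (rule sum.swap)
  finally show ?thesis
    by (simp add: sum_distrib_left mult_ac)
qed

lemma sum_mat_1_mult: "(\<Sum>k\<in>UNIV. mat 1 $ i $ k * f k) = (f i :: real)"
  by (simp add: mat_def if_distrib if_distribR cong: if_cong)

lemma kron_eigenvector:
  assumes "A *v x = a *s x" "B *v y = b *s y"
  shows "kron A B *v (\<chi> p. x $ fst p * y $ snd p) = (a * b) *s (\<chi> p. x $ fst p * y $ snd p)"
proof -
  have x: "(\<Sum>k\<in>UNIV. A $ i $ k * x $ k) = a * x $ i" for i
    using arg_cong[OF assms(1), of "\<lambda>v. v $ i"] by (simp add: matrix_vector_mult_def)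
  have y: "(\<Sum>k\<in>UNIV. B $ i $ k * y $ k) = b * y $ i" for i
    using arg_cong[OF assms(2), of "\<lambda>v. v $ i"] by (simp add: matrix_vector_mult_def)
  have "(\<Sum>l\<in>UNIV. B $ j $ l * (\<Sum>k\<in>UNIV. A $ i $ k * (x $ k * y $ l))) = a * b * (x $ i * y $ j)" for i j
  proof -
    have "(\<Sum>l\<in>UNIV. B $ j $ l * (\<Sum>k\<in>UNIV. A $ i $ k * (x $ k * y $ l)))
        = (\<Sum>l\<in>UNIV. (B $ j $ l * y $ l) * (\<Sum>k\<in>UNIV. A $ i $ k * x $ k))"
      by (simp add: sum_distrib_left sum_distrib_right mult_ac)
    also have "\<dots> = (b * y $ j) * (a * x $ i)"
      unfolding x by (simp add: y flip: sum_distrib_right)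
    finally show ?thesis by simp
  qed
  then show ?thesis
    by (simp add: vec_eq_iff kron_mult_vec_nth)
qed

lemma scaleR_matrix_vector_mult: "(c *\<^sub>R A) *v x = c *\<^sub>R (A *v (x :: real^'n))"
  by (simp add: vec_eq_iff matrix_vector_mult_def sum_distrib_left mult.assoc)

text \<open>Every vector is fixed by \<open>mat 1\<close>, so the tensor product of x and y is a
  common eigenvector of all four Kronecker terms, with eigenvalues 1, a, b and a b.\<close>

lemma belief_jacobian_eigenvector:
  fixes Aa :: "real^'a^'a" and Ao :: "real^'o^'o"
  assumes "Aa *v x = a *s x" "Ao *v y = b *s y"
  shows "belief_jacobian d \<alpha> \<gamma> \<beta> \<delta> Aa Ao u *v (\<chi> p. x $ fst p * y $ snd p) =
    (- d + u * (\<alpha> + \<gamma> * a + \<beta> * b + \<delta> * a * b)) *s (\<chi> p. x $ fst p * y $ snd p)"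
proof -
  have "mat 1 *v x = 1 *s x" "mat 1 *v y = 1 *s y"
    by simp_all
  note eigen = kron_eigenvector[OF this] kron_eigenvector[OF assms(1) this(2)]
    kron_eigenvector[OF this(1) assms(2)] kron_eigenvector[OF assms]
  show ?thesis
    unfolding belief_jacobian_def matrix_vector_mult_add_rdistrib scaleR_matrix_vector_mult eigen
    by (simp add: vec_eq_iff algebra_simps)
qed

section \<open>Linearization of the belief dynamics at the origin\<close>

text \<open>Chain rule at g 0 = 0: since S has slope 1 there, it leaves no trace at first
  order.\<close>

lemma saturating_has_derivative_linear:
  assumes "saturating S" and g: "bounded_linear g"
  shows "((\<lambda>Z. S (g Z)) has_derivative g) (at 0)"
proof -
  have "S field_differentiable at 0" "deriv S 0 = 1"
    using assms(1) unfolding saturating_def by (auto dest: eventually_nhds_x_imp_x)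
  then have "(S has_field_derivative 1) (at 0)"
    by (metis DERIV_deriv_iff_field_differentiable)
  then have "(S has_derivative (*) 1) (at (g 0))"
    by (simp add: has_field_derivative_def linear_0[OF bounded_linear.linear[OF g]])
  from has_derivative_compose[OF bounded_linear_imp_has_derivative[OF g] this]
  show ?thesis by simp
qed

text \<open>To first order \<open>S1\<close> and \<open>S2\<close> act as the identity, and the zero
  diagonals of \<open>Aa\<close> and \<open>Ao\<close> let the sums over k \<noteq> i and l \<noteq>
  j run over all indices, which produces the Kronecker terms.\<close>

lemma jacobian_belief_field:
  fixes Aa :: "real^'a^'a" and Ao :: "real^'o^'o"
  assumes Aa: "signed_adjacency Aa" and Ao: "signed_adjacency Ao"
    and S: "saturating S1" "saturating S2"
  shows "jacobian (belief_field S1 S2 d \<alpha> \<gamma> \<beta> \<delta> Aa Ao u) (at 0) = belief_jacobian d \<alpha> \<gamma> \<beta> \<delta> Aa Ao u"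
proof -
  have bl: "bounded_linear (\<lambda>Z :: real^('a \<times> 'o). \<Sum>k\<in>X. c k * Z $ f k)" for X c and f :: "'a \<Rightarrow> 'a \<times> 'o"
    by (intro bounded_linear_sum bounded_linear_const_mult bounded_linear_vec_nth)
  have drop_diag_a: "(\<Sum>k\<in>UNIV - {i}. Aa $ i $ k * f k) = (\<Sum>k\<in>UNIV. Aa $ i $ k * f k)" for i f
    using Aa by (intro sum.mono_neutral_left) (auto simp: signed_adjacency_def)
  have drop_diag_o: "(\<Sum>l\<in>UNIV - {j}. Ao $ j $ l * f l) = (\<Sum>l\<in>UNIV. Ao $ j $ l * f l)" for j f
    using Ao by (intro sum.mono_neutral_left) (auto simp: signed_adjacency_def)
  have comp: "((\<lambda>Z. belief_field S1 S2 d \<alpha> \<gamma> \<beta> \<delta> Aa Ao u Z $ (i, j)) has_derivative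
      (\<lambda>Z. (belief_jacobian d \<alpha> \<gamma> \<beta> \<delta> Aa Ao u *v Z) $ (i, j))) (at 0)" for i j
  proof -
    let ?g1 = "\<lambda>Z :: real^('a \<times> 'o). \<alpha> * Z $ (i, j) + \<gamma> * (\<Sum>k\<in>UNIV - {i}. Aa $ i $ k * Z $ (k, j))"
    let ?g2 = "\<lambda>l (Z :: real^('a \<times> 'o)). \<beta> * Ao $ j $ l * Z $ (i, l) +
                 \<delta> * Ao $ j $ l * (\<Sum>k\<in>UNIV - {i}. Aa $ i $ k * Z $ (k, l))"
    have g1: "bounded_linear ?g1"
      by (intro bounded_linear_add bounded_linear_const_mult bounded_linear_vec_nth bl)
    have g2: "bounded_linear (?g2 l)" for l
      by (intro bounded_linear_add bounded_linear_const_mult bounded_linear_vec_nth bl)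
    have "((\<lambda>Z. - d * Z $ (i, j) + u * (S1 (?g1 Z) + (\<Sum>l\<in>UNIV - {j}. S2 (?g2 l Z)))) has_derivative
        (\<lambda>Z. - d * Z $ (i, j) + u * (?g1 Z + (\<Sum>l\<in>UNIV - {j}. ?g2 l Z)))) (at 0)"
      by (intro has_derivative_add has_derivative_mult_right has_derivative_sum
          saturating_has_derivative_linear S g1 g2 bounded_linear_imp_has_derivative
          bounded_linear_vec_nth)
    moreover have "- d * Z $ (i, j) + u * (?g1 Z + (\<Sum>l\<in>UNIV - {j}. ?g2 l Z)) =
        (belief_jacobian d \<alpha> \<gamma> \<beta> \<delta> Aa Ao u *v Z) $ (i, j)" for Z
    proof -
      have "(\<Sum>l\<in>UNIV - {j}. ?g2 l Z) =
          (\<Sum>l\<in>UNIV - {j}. Ao $ j $ l * (\<beta> * Z $ (i, l) + \<delta> * (\<Sum>k\<in>UNIV. Aa $ i $ k * Z $ (k, l))))"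
        by (simp add: drop_diag_a algebra_simps)
      also have "\<dots> = \<beta> * (\<Sum>l\<in>UNIV. Ao $ j $ l * Z $ (i, l)) +
          \<delta> * (\<Sum>l\<in>UNIV. Ao $ j $ l * (\<Sum>k\<in>UNIV. Aa $ i $ k * Z $ (k, l)))"
        unfolding drop_diag_o by (simp add: distrib_left sum.distrib sum_distrib_left mult_ac)
      finally show ?thesis
        unfolding belief_jacobian_def matrix_vector_mult_add_rdistrib scaleR_matrix_vector_mult
        by (simp add: drop_diag_a kron_mult_vec_nth sum_mat_1_mult) (simp add: algebra_simps)
    qed
    ultimately show ?thesis
      by (simp add: belief_field_def)
  qed
  have "(belief_field S1 S2 d \<alpha> \<gamma> \<beta> \<delta> Aa Ao u has_derivative (*v) (belief_jacobian d \<alpha> \<gamma> \<beta> \<delta> Aa Ao u)) (at 0)"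
  proof (rule has_derivative_componentwise_within[THEN iffD2], rule ballI)
    fix e :: "real^('a \<times> 'o)"
    assume "e \<in> Basis"
    then obtain i j where "e = axis (i, j) 1"
      by (auto simp: Basis_vec_def)
    then show "((\<lambda>Z. inner (belief_field S1 S2 d \<alpha> \<gamma> \<beta> \<delta> Aa Ao u Z) e) has_derivative
        (\<lambda>Z. inner (belief_jacobian d \<alpha> \<gamma> \<beta> \<delta> Aa Ao u *v Z) e)) (at 0)"
      using comp[of i j] by (simp add: inner_axis)
  qed
  then show ?thesis
    \<comment> \<open>\<open>jacobian\<close> is the matrix of the Frechet derivative, which is
      unique, so the derivative just found determines it.\<close>
    unfolding jacobian_def by (metis frechet_derivative_at matrix_of_matrix_vector_mul)
qed

section \<open>Imaginary eigenvalues of symmetric matrices, and the value of K in the Perron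
  case\<close>

text \<open>Split an eigenvector as a + i b. Then A a = -w b and A b = w a, and symmetry of A, which
  equates the inner products of b with A a and of A b with a, gives w (|a|^2 + |b|^2) = 0.\<close>

lemma symmetric_spectrum_imaginary_eq_0:
  fixes A :: "real^'n^'n"
  assumes "transpose A = A" "Complex 0 w \<in> spectrum A"
  shows "w = 0"
proof -
  from assms(2) obtain v where v: "v \<noteq> 0" "map_matrix complex_of_real A *v v = Complex 0 w *s v"
    unfolding spectrum_def by blast
  define a b where "a = (\<chi> i. Re (v $ i))" and "b = (\<chi> i. Im (v $ i))"
  have v_nth: "(\<Sum>j\<in>UNIV. complex_of_real (A $ i $ j) * v $ j) = Complex 0 w * v $ i" for i
    using arg_cong[OF v(2), of "\<lambda>x. x $ i"] by (simp add: matrix_vector_mult_def)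
  have Aa: "A *v a = (- w) *\<^sub>R b" and Ab: "A *v b = w *\<^sub>R a"
    using arg_cong[OF v_nth, of Re] arg_cong[OF v_nth, of Im]
    by (simp_all add: vec_eq_iff matrix_vector_mult_def a_def b_def)
  have "inner b (A *v a) = inner (A *v b) a"
    using dot_lmul_matrix[of b A a] assms(1) by (metis transpose_matrix_vector)
  then have "w * (inner a a + inner b b) = 0"
    unfolding Aa Ab by (simp add: algebra_simps)
  moreover have "inner a a + inner b b \<noteq> 0"
  proof
    assume "inner a a + inner b b = 0"
    then have "a = 0 \<and> b = 0"
      by (simp add: add_nonneg_eq_0_iff)
    then show False
      using v(1) by (auto simp: vec_eq_iff a_def b_def complex_eq_iff)
  qed
  ultimately show ?thesis by simp
qed

text \<open>With nonnegative coefficients the three terms Re l, Re m and Re (l m) can be bounded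
  separately, and the single pair (a, b) attains all three bounds.\<close>

lemma belief_K_dominant:
  assumes "\<alpha> \<ge> 0" "\<gamma> \<ge> 0" "\<beta> \<ge> 0" "\<delta> \<ge> 0"
    and a: "a \<ge> 0" "complex_of_real a \<in> spectrum Aa" "\<forall>z\<in>spectrum Aa. cmod z \<le> a"
    and b: "b \<ge> 0" "complex_of_real b \<in> spectrum Ao" "\<forall>z\<in>spectrum Ao. cmod z \<le> b"
  shows "belief_K \<alpha> \<gamma> \<beta> \<delta> Aa Ao = \<alpha> + \<gamma> * a + \<beta> * b + \<delta> * a * b"
  unfolding belief_K_def
proof (rule Max_eqI)
  show "finite ((\<lambda>(l, m). Re (of_real \<alpha> + of_real \<gamma> * l + of_real \<beta> * m + of_real \<delta> * l * m)) `
      (spectrum Aa \<times> spectrum Ao))"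
    by (simp add: finite_spectrum)
  show "\<alpha> + \<gamma> * a + \<beta> * b + \<delta> * a * b \<in>
      (\<lambda>(l, m). Re (of_real \<alpha> + of_real \<gamma> * l + of_real \<beta> * m + of_real \<delta> * l * m)) `
      (spectrum Aa \<times> spectrum Ao)"
    by (rule image_eqI[of _ _ "(complex_of_real a, complex_of_real b)"]) (simp_all add: a b)
next
  fix t
  assume "t \<in> (\<lambda>(l, m). Re (of_real \<alpha> + of_real \<gamma> * l + of_real \<beta> * m + of_real \<delta> * l * m)) `
      (spectrum Aa \<times> spectrum Ao)"
  then obtain l m where lm: "l \<in> spectrum Aa" "m \<in> spectrum Ao"
    and t: "t = \<alpha> + \<gamma> * Re l + \<beta> * Re m + \<delta> * Re (l * m)"
    by (auto simp: algebra_simps)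
  have "Re l \<le> a" "Re m \<le> b"
    using a(3) b(3) lm complex_Re_le_cmod order_trans by blast+
  \<comment> \<open>Here bounds on real parts would not suffice: two eigenvalues with negative real
    parts or large imaginary parts may have a product with large real part. Dominance in modulus
    controls it.\<close>
  moreover have "Re (l * m) \<le> a * b"
  proof -
    have "Re (l * m) \<le> cmod l * cmod m"
      using complex_Re_le_cmod[of "l * m"] by (simp add: norm_mult)
    also have "\<dots> \<le> a * b"
      using a b lm by (intro mult_mono) auto
    finally show ?thesis .
  qed
  ultimately show "t \<le> \<alpha> + \<gamma> * a + \<beta> * b + \<delta> * a * b"
    unfolding t mult.assoc[of \<delta>] using assms(2-4) by (intro add_mono mult_left_mono) auto
qed

section \<open>Exclusion of the Hopf point in the symmetric and in the eventually positive
  case\<close>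

theorem propositionV1:
  fixes Aa :: "real^'a^'a" and Ao :: "real^'o^'o"
    and S1 S2 :: "real \<Rightarrow> real"
    and d \<alpha> \<gamma> \<beta> \<delta> :: real
  assumes "signed_adjacency Aa" and "signed_adjacency Ao"
    and "saturating S1" and "saturating S2"
    and "d > 0" and "\<alpha> \<ge> 0" and "\<gamma> \<ge> 0" and "\<beta> \<ge> 0" and "\<delta> \<ge> 0"
    and "belief_K \<alpha> \<gamma> \<beta> \<delta> Aa Ao > 0"
    and "(transpose Aa = Aa \<and> transpose Ao = Ao) \<or>
         (\<exists>Ma Mo. switching_matrix Ma \<and> switching_matrix Mo \<and>
            eventually_positive (Ma ** Aa ** Ma) \<and> eventually_positive (Mo ** Ao ** Mo))"
  shows "\<not> hopf_bifurcation_point (belief_field S1 S2 d \<alpha> \<gamma> \<beta> \<delta> Aa Ao) 0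
            (d / belief_K \<alpha> \<gamma> \<beta> \<delta> Aa Ao)"
proof
  define K where "K = belief_K \<alpha> \<gamma> \<beta> \<delta> Aa Ao"
  define J where "J = belief_jacobian d \<alpha> \<gamma> \<beta> \<delta> Aa Ao (d / K)"
  assume "hopf_bifurcation_point (belief_field S1 S2 d \<alpha> \<gamma> \<beta> \<delta> Aa Ao) 0
            (d / belief_K \<alpha> \<gamma> \<beta> \<delta> Aa Ao)"
  \<comment> \<open>A nonzero imaginary eigenvalue is what symmetry forbids; the confinement of
    imaginary eigenvalues to the pair is what a zero eigenvalue violates.\<close>
  then obtain w where w: "w \<noteq> 0" "Complex 0 w \<in> spectrum J"
    "\<And>z. z \<in> spectrum J \<Longrightarrow> Re z = 0 \<Longrightarrow> z \<in> {Complex 0 w, Complex 0 (- w)}"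
    unfolding hopf_bifurcation_point_def Let_def jacobian_belief_field[OF assms(1-4)] J_def K_def
    by blast
  from assms(11) show False
  proof
    assume "transpose Aa = Aa \<and> transpose Ao = Ao"
    then have entries: "Aa $ j $ i = Aa $ i $ j" "Ao $ l $ k = Ao $ k $ l" for i j k l
      by (metis transpose_def vec_lambda_beta)+
    \<comment> \<open>Kronecker products of symmetric matrices are symmetric, and J is a linear
      combination of four of them.\<close>
    have "transpose J = J"
      by (simp add: J_def belief_jacobian_def kron_def transpose_def vec_eq_iff mat_def entries eq_commute)
    then show False
      using symmetric_spectrum_imaginary_eq_0 w(1,2) by blast
  next
    assume "\<exists>Ma Mo. switching_matrix Ma \<and> switching_matrix Mo \<and>
            eventually_positive (Ma ** Aa ** Ma) \<and> eventually_positive (Mo ** Ao ** Mo)"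
    then obtain Ma Mo where M: "switching_matrix Ma" "eventually_positive (Ma ** Aa ** Ma)"
      "switching_matrix Mo" "eventually_positive (Mo ** Ao ** Mo)"
      by blast
    obtain a x where a: "a \<ge> 0" "x \<noteq> 0" "Aa *v x = a *s x" "\<forall>z\<in>spectrum Aa. cmod z \<le> a"
      using switched_dominant_eigenvalue[OF M(1,2)] by blast
    obtain b y where b: "b \<ge> 0" "y \<noteq> 0" "Ao *v y = b *s y" "\<forall>z\<in>spectrum Ao. cmod z \<le> b"
      using switched_dominant_eigenvalue[OF M(3,4)] by blast
    let ?v = "\<chi> p. x $ fst p * y $ snd p"
    have "K = \<alpha> + \<gamma> * a + \<beta> * b + \<delta> * a * b"
      unfolding K_def
      by (intro belief_K_dominant assms a b spectrum_of_real[OF a(3,2)] spectrum_of_real[OF b(3,2)])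
    \<comment> \<open>The factor multiplying u in the eigenvalue of \<open>?v\<close> is exactly K,
      so the choice u = d / K cancels -d.\<close>
    then have "J *v ?v = (- d + d / K * K) *s ?v"
      unfolding J_def by (simp only: belief_jacobian_eigenvector[OF a(3) b(3)])
    also have "- d + d / K * K = 0"
      using assms(10) by (simp add: K_def)
    finally have "J *v ?v = 0 *s ?v" .
    \<comment> \<open>A nonzero coordinate of x and one of y give a nonzero coordinate of their
      tensor product.\<close>
    moreover have "?v \<noteq> 0"
      using a(2) b(2) by (auto simp: vec_eq_iff)
    ultimately have "0 \<in> spectrum J"
      using spectrum_of_real[of J ?v 0] by simp
    then show False
      using w(1) w(3)[of 0] by (simp add: complex_eq_iff)
  qed
qed

end
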